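(* Let $t\ge 3$ be an integer, $G=(V,E)$ a simple undirected graph in which every vertex has degree at least $1$ and at most $t+1$, and $w:E\to\mathbb{R}_{\ge 0}$ a weight function that is vertex-induced on every $K_{t+1}$ and every $K_{t,t}$ of $G$. Assume that the forbidden subgraphs of $G$ (its $K_{t+1}$'s and $K_{t,t}$'s) are pairwise vertex-disjoint, and let $G'=(V',E')$, $w'$, $l$, $b$ be as constructed below. Then for every covering co-$t$-matching $\bar M$ of $G$ there exists an $(l,b)$-matching $M'$ of $G'$ with $w'(M')=w(\bar M)$.
   Context: A "$K_{t+1}$ of $G$" (resp. "$K_{t,t}$ of $G$") is a subgraph of $G$, not necessarily induced, isomorphic to the complete graph on $t+1$ vertices (resp. to the complete bipartite graph with color classes $V_1(H),V_2(H)$ of size $t$). $w$ is vertex-induced on a subgraph $H$ if there is $r_H:V(H)\to\mathbb{R}$ (a potential function) with $w(u,v)=r_H(u)+r_H(v)$ for every edge $(u,v)$ of $H$. A set $\bar M\subseteq E$ is a co-$t$-matching if $E\setminus\bar M$ is a $t$-matching (every vertex incident to at most $t$ of its edges); it is covering if moreover $E\setminus\bar M$ contains the edge set of no $K_{t+1}$ and no $K_{t,t}$ of $G$ (equivalently $\bar M$ contains at least one edge of each). Construction: start with $G'=G$, $w'(e)=w(e)$ for $e\in E$; for each vertex $v$ of $G$ set the capacity interval $[l(v),b(v)]=[1,t+1]$ if $\deg_G(v)=t+1$ and $[0,\deg_G(v)]$ otherwise. For each $K_{t+1}$ $H$ of $G$, with a fixed potential function $r_H$, add a new vertex $u_H$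 with capacity interval $[2,2]$ and, for each vertex $v$ of $H$, an edge $(v,u_H)$ of weight $r_H(v)$. For each $K_{t,t}$ $H$ of $G$, with a fixed potential function $r_H$, add new vertices $u^1_H,u^2_H$ with capacity intervals $[1,1]$, and edges $(v,u^i_H)$ of weight $r_H(v)$ for every $v\in V_i(H)$, $i=1,2$. An $(l,b)$-matching of $G'$ is a set $M'\subseteq E'$ with $l(v)\le \deg_{M'}(v)\le b(v)$ for all $v\in V'$; $w'(M')$ is the sum of weights of its edges. *)

theory Defs
  imports Complex_Main
begin

datatype 'a ugraph = UGraph (verts: "'a set") (edges: "'a set set")

definition simple_graph :: "'a ugraph \<Rightarrow> bool" where
  "simple_graph G \<longleftrightarrow> finite (verts G) \<and>
     edges G \<subseteq> {{u, v} | u v. u \<in> verts G \<and> v \<in> verts G \<and> u \<noteq> v}"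

definition subgraph :: "'a ugraph \<Rightarrow> 'a ugraph \<Rightarrow> bool" where
  "subgraph H G \<longleftrightarrow> simple_graph H \<and> verts H \<subseteq> verts G \<and> edges H \<subseteq> edges G"

definition deg_in :: "'a set set \<Rightarrow> 'a \<Rightarrow> nat" where
  "deg_in M v = card {e \<in> M. v \<in> e}"

definition complete_graph :: "nat \<Rightarrow> 'a ugraph \<Rightarrow> bool" where
  "complete_graph n H \<longleftrightarrow> finite (verts H) \<and> card (verts H) = n \<and>
     edges H = {{u, v} | u v. u \<in> verts H \<and> v \<in> verts H \<and> u \<noteq> v}"

definition complete_bipartite :: "nat \<Rightarrow> 'a set \<Rightarrow> 'a set \<Rightarrow> 'a ugraph \<Rightarrow> bool" where
  "complete_bipartite n A B H \<longleftrightarrow>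
     finite A \<and> finite B \<and> A \<inter> B = {} \<and> card A = n \<and> card B = n \<and>
     verts H = A \<union> B \<and> edges H = {{a, b} | a b. a \<in> A \<and> b \<in> B}"

text \<open>The subgraphs (not necessarily induced) of \<open>G\<close> isomorphic to $K_{t+1}$, resp. $K_{t,t}$.\<close>

definition cliques :: "nat \<Rightarrow> 'a ugraph \<Rightarrow> 'a ugraph set" where
  "cliques t G = {H. subgraph H G \<and> complete_graph (t + 1) H}"

definition bicliques :: "nat \<Rightarrow> 'a ugraph \<Rightarrow> 'a ugraph set" where
  "bicliques t G = {H. subgraph H G \<and> (\<exists>A B. complete_bipartite t A B H)}"

definition forbidden :: "nat \<Rightarrow> 'a ugraph \<Rightarrow> 'a ugraph set" where
  "forbidden t G = cliques t G \<union> bicliques t G"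

definition potential_on :: "('a set \<Rightarrow> real) \<Rightarrow> 'a ugraph \<Rightarrow> ('a \<Rightarrow> real) \<Rightarrow> bool" where
  "potential_on w H p \<longleftrightarrow> (\<forall>u v. {u, v} \<in> edges H \<longrightarrow> w {u, v} = p u + p v)"

definition vertex_induced :: "('a set \<Rightarrow> real) \<Rightarrow> 'a ugraph \<Rightarrow> bool" where
  "vertex_induced w H \<longleftrightarrow> (\<exists>p. potential_on w H p)"

definition t_matching :: "nat \<Rightarrow> 'a ugraph \<Rightarrow> 'a set set \<Rightarrow> bool" where
  "t_matching t G M \<longleftrightarrow> M \<subseteq> edges G \<and> (\<forall>v\<in>verts G. deg_in M v \<le> t)"

definition co_t_matching :: "nat \<Rightarrow> 'a ugraph \<Rightarrow> 'a set set \<Rightarrow> bool" where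
  "co_t_matching t G M \<longleftrightarrow> M \<subseteq> edges G \<and> t_matching t G (edges G - M)"

definition covering_co_t_matching :: "nat \<Rightarrow> 'a ugraph \<Rightarrow> 'a set set \<Rightarrow> bool" where
  "covering_co_t_matching t G M \<longleftrightarrow> co_t_matching t G M \<and>
     (\<forall>H\<in>forbidden t G. \<not> edges H \<subseteq> edges G - M)"

definition lb_matching ::
  "'a ugraph \<Rightarrow> ('a \<Rightarrow> nat) \<Rightarrow> ('a \<Rightarrow> nat) \<Rightarrow> 'a set set \<Rightarrow> bool" where
  "lb_matching G l b M \<longleftrightarrow> M \<subseteq> edges G \<and>
     (\<forall>v\<in>verts G. l v \<le> deg_in M v \<and> deg_in M v \<le> b v)"

text \<open>Vertices of the auxiliary graph: \<open>Orig v\<close> is the copy of the vertex \<open>v\<close> of \<open>G\<close>,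
  \<open>KHub H\<close> is $u_H$ for a $K_{t+1}$ \<open>H\<close>, and \<open>BHub1 H\<close>, \<open>BHub2 H\<close> are
  $u^1_H$, $u^2_H$ for a $K_{t,t}$ \<open>H\<close>.\<close>

datatype 'a xvertex = Orig 'a | KHub "'a ugraph" | BHub1 "'a ugraph" | BHub2 "'a ugraph"

text \<open>The arguments \<open>V1\<close> and \<open>V2\<close> fix, for each $K_{t,t}$ \<open>H\<close>, which colour class is the
  first one and which is the second one.\<close>

definition aux_graph ::
  "nat \<Rightarrow> 'a ugraph \<Rightarrow> ('a ugraph \<Rightarrow> 'a set) \<Rightarrow> ('a ugraph \<Rightarrow> 'a set) \<Rightarrow> 'a xvertex ugraph" where
  "aux_graph t G V1 V2 = UGraph
     (Orig ` verts G \<union> KHub ` cliques t G \<union> BHub1 ` bicliques t G \<union> BHub2 ` bicliques t G)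
     ((`) Orig ` edges G
       \<union> {{Orig v, KHub H} | v H. H \<in> cliques t G \<and> v \<in> verts H}
       \<union> {{Orig v, BHub1 H} | v H. H \<in> bicliques t G \<and> v \<in> V1 H}
       \<union> {{Orig v, BHub2 H} | v H. H \<in> bicliques t G \<and> v \<in> V2 H})"

text \<open>The description in the second branch is unique on every gadget edge; the lemmas
  \<open>aux_weight_Orig\<close> and \<open>aux_weight_hub\<close> below give the values on all edges of \<open>aux_graph\<close>.\<close>

definition aux_weight ::
  "('a set \<Rightarrow> real) \<Rightarrow> ('a ugraph \<Rightarrow> 'a \<Rightarrow> real) \<Rightarrow> 'a xvertex set \<Rightarrow> real" where
  "aux_weight w r e =
     (if e \<subseteq> range Orig then w (Orig -` e)
      else (THE c. \<exists>v H. e \<in> {{Orig v, KHub H}, {Orig v, BHub1 H}, {Orig v, BHub2 H}} \<and> c = r H v))"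

fun aux_lower :: "nat \<Rightarrow> 'a ugraph \<Rightarrow> 'a xvertex \<Rightarrow> nat" where
  "aux_lower t G (Orig v) = (if deg_in (edges G) v = t + 1 then 1 else 0)"
| "aux_lower t G (KHub H) = 2"
| "aux_lower t G (BHub1 H) = 1"
| "aux_lower t G (BHub2 H) = 1"

fun aux_upper :: "nat \<Rightarrow> 'a ugraph \<Rightarrow> 'a xvertex \<Rightarrow> nat" where
  "aux_upper t G (Orig v) =
     (if deg_in (edges G) v = t + 1 then t + 1 else deg_in (edges G) v)"
| "aux_upper t G (KHub H) = 2"
| "aux_upper t G (BHub1 H) = 1"
| "aux_upper t G (BHub2 H) = 1"

lemma aux_weight_Orig: "aux_weight w r (Orig ` e) = w e"
proof -
  have "Orig -` (Orig ` e) = e"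
    by (rule inj_vimage_image_eq) (simp add: inj_def)
  then show ?thesis
    by (simp add: aux_weight_def image_mono)
qed

lemma aux_weight_hub:
  "aux_weight w r {Orig v, KHub H} = r H v"
  "aux_weight w r {Orig v, BHub1 H} = r H v"
  "aux_weight w r {Orig v, BHub2 H} = r H v"
  by (auto simp: aux_weight_def doubleton_eq_iff intro!: the_equality)

end

theory Submission
  imports Defs
begin

text \<open>From each forbidden subgraph \<open>H\<close> choose an edge \<open>{a H, b H}\<close> of the
  covering co-\<open>t\<close>-matching and replace it by the two gadget edges joining \<open>a H\<close> and \<open>b H\<close> to the
  new vertices of \<open>H\<close>. Since the forbidden subgraphs are disjoint, the chosen edges are disjoint.
  The exchange changes neither the degree at an original vertex nor, by the potential function of
  \<open>H\<close>, the weight.\<close>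

definition reroute ::
  "'i set \<Rightarrow> ('i \<Rightarrow> 'a) \<Rightarrow> ('i \<Rightarrow> 'a) \<Rightarrow> ('i \<Rightarrow> 'a xvertex) \<Rightarrow> ('i \<Rightarrow> 'a xvertex) \<Rightarrow>
    'a set set \<Rightarrow> 'a xvertex set set" where
  "reroute I a b h k M = (`) Orig ` (M - (\<lambda>i. {a i, b i}) ` I)
     \<union> (\<lambda>i. {Orig (a i), h i}) ` I \<union> (\<lambda>i. {Orig (b i), k i}) ` I"

text \<open>Writing a degree as a sum of indicators lets one summation formula handle both degrees
  and weights.\<close>

lemma deg_in_eq_sum:
  assumes "finite M"
  shows "deg_in M v = (\<Sum>e\<in>M. of_bool (v \<in> e))"
  using assms by (simp add: deg_in_def Collect_conj_eq Int_commute)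

lemma finite_edges: "simple_graph G \<Longrightarrow> finite (edges G)"
  by (rule finite_subset[of _ "Pow (verts G)"]) (auto simp: simple_graph_def)

text \<open>The vertex counts \<open>t + 1\<close> and \<open>2 * t\<close> agree only for
  \<open>t = 1\<close>, where both graphs are a single edge. This keeps the two kinds of gadget
  apart.\<close>

lemma complete_not_complete_bipartite:
  assumes "t \<noteq> 1" "complete_graph (t + 1) H"
  shows "\<not> complete_bipartite t A B H"
proof
  assume "complete_bipartite t A B H"
  then have "card (verts H) = t + t"
    by (auto simp: complete_bipartite_def card_Un_disjoint)
  with assms show False
    by (simp add: complete_graph_def)
qed

text \<open>The setting treats both gadgets at once: \<open>h i\<close> and \<open>k i\<close> may
  be the same hub, as for a clique, or two hubs, as for a biclique. Vertex-disjointness of the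
  forbidden subgraphs enters through \<open>inj_a\<close>, \<open>inj_b\<close> and
  \<open>a_neq_b\<close>, the last of which includes the case \<open>i = j\<close>.\<close>

context
  fixes I :: "'i set" and a b :: "'i \<Rightarrow> 'a" and h k :: "'i \<Rightarrow> 'a xvertex" and M :: "'a set set"
  assumes finM: "finite M" and finI: "finite I"
    and chosen: "\<And>i. i \<in> I \<Longrightarrow> {a i, b i} \<in> M"
    and inj_a: "inj_on a I" and inj_b: "inj_on b I"
    and a_neq_b: "\<And>i j. i \<in> I \<Longrightarrow> j \<in> I \<Longrightarrow> a i \<noteq> b j"
    and hub: "\<And>i. i \<in> I \<Longrightarrow> h i \<notin> range Orig" "\<And>i. i \<in> I \<Longrightarrow> k i \<notin> range Orig"
begin

lemma finite_reroute: "finite (reroute I a b h k M)"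
  using finM finI by (simp add: reroute_def)

text \<open>The three parts of \<open>reroute\<close> are disjoint and indexed injectively, because
  a gadget edge has exactly one original endpoint and this endpoint determines both \<open>i\<close>
  and the side. The values lie in any commutative monoid, so that \<open>g\<close> can be a real
  weight or a natural-number indicator.\<close>

lemma sum_reroute:
  fixes g :: "'a xvertex set \<Rightarrow> 'b::comm_monoid_add"
  shows "sum g (reroute I a b h k M) =
    (\<Sum>e\<in>M - (\<lambda>i. {a i, b i}) ` I. g (Orig ` e)) +
    (\<Sum>i\<in>I. g {Orig (a i), h i} + g {Orig (b i), k i})"
proof -
  let ?O = "(`) Orig ` (M - (\<lambda>i. {a i, b i}) ` I)"
  let ?A = "(\<lambda>i. {Orig (a i), h i}) ` I" and ?B = "(\<lambda>i. {Orig (b i), k i}) ` I"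
  have "?O \<inter> ?A = {}" "?O \<inter> ?B = {}"
    using hub by blast+
  moreover have "?A \<inter> ?B = {}"
    using a_neq_b hub by (fastforce simp: doubleton_eq_iff)
  ultimately have "sum g (reroute I a b h k M) = sum g ?O + sum g ?A + sum g ?B"
    using finM finI by (simp add: reroute_def sum.union_disjoint Int_Un_distrib2)
  moreover have "inj_on ((`) Orig) (M - (\<lambda>i. {a i, b i}) ` I)"
    by (simp add: inj_on_def inj_image_eq_iff inj_def)
  moreover have "inj_on (\<lambda>i. {Orig (a i), h i}) I"
    using inj_a hub by (fastforce simp: inj_on_def doubleton_eq_iff)
  moreover have "inj_on (\<lambda>i. {Orig (b i), k i}) I"
    using inj_b hub by (fastforce simp: inj_on_def doubleton_eq_iff)
  ultimately show ?thesis
    by (simp add: sum.reindex sum.distrib add.assoc)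
qed

text \<open>Exchange principle: a quantity balanced in each single exchange is preserved overall. It
  is applied to the weight and to the degree at an original vertex.\<close>

lemma sum_reroute_eq:
  fixes g :: "'a xvertex set \<Rightarrow> 'b::comm_monoid_add"
  assumes "\<And>i. i \<in> I \<Longrightarrow> g {Orig (a i), h i} + g {Orig (b i), k i} = g (Orig ` {a i, b i})"
  shows "sum g (reroute I a b h k M) = (\<Sum>e\<in>M. g (Orig ` e))"
proof -
  let ?R = "(\<lambda>i. {a i, b i}) ` I"
  have "inj_on (\<lambda>i. {a i, b i}) I"
    using inj_a a_neq_b by (auto simp: inj_on_def doubleton_eq_iff)
  then have "(\<Sum>i\<in>I. g {Orig (a i), h i} + g {Orig (b i), k i}) = (\<Sum>e\<in>?R. g (Orig ` e))"
    using assms by (simp add: sum.reindex)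
  moreover have "?R \<subseteq> M"
    using chosen by blast
  ultimately show ?thesis
    using finM by (simp add: sum_reroute sum.subset_diff[of ?R M])
qed

lemma deg_in_reroute_Orig: "deg_in (reroute I a b h k M) (Orig v) = deg_in M v"
proof -
  have "h i \<noteq> Orig x" "k i \<noteq> Orig x" "Orig x \<noteq> h i" "Orig x \<noteq> k i"
    if "i \<in> I" for i x
    using hub[OF that] by (metis rangeI)+
  \<comment> \<open>Local balance for the indicator of \<open>Orig v\<close>: since
    \<open>a i\<close> and \<open>b i\<close> differ, at most one summand on the left is 1.\<close>
  then have "(of_bool (Orig v \<in> {Orig (a i), h i}) + of_bool (Orig v \<in> {Orig (b i), k i}) :: nat)
      = of_bool (Orig v \<in> Orig ` {a i, b i})" if "i \<in> I" for i
    using a_neq_b[OF that that] that by auto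
  then have "deg_in (reroute I a b h k M) (Orig v) = (\<Sum>e\<in>M. of_bool (Orig v \<in> Orig ` e))"
    by (simp only: deg_in_eq_sum[OF finite_reroute] sum_reroute_eq)
  moreover have "Orig v \<in> Orig ` e \<longleftrightarrow> v \<in> e" for e
    by auto
  ultimately show ?thesis
    by (simp only: deg_in_eq_sum[OF finM])
qed

text \<open>Only the exchange at \<open>j\<close> can touch \<open>x\<close>. The two indicators add
  up to 2 if \<open>h j\<close> and \<open>k j\<close> both equal \<open>x\<close>, which gives the
  capacity of a clique hub, and to 1 if exactly one of them does.\<close>

lemma deg_in_reroute_hub:
  assumes "x \<notin> range Orig" "j \<in> I" "\<And>i. i \<in> I \<Longrightarrow> x \<in> {h i, k i} \<Longrightarrow> i = j"
  shows "deg_in (reroute I a b h k M) x = of_bool (x = h j) + of_bool (x = k j)"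
proof -
  have "x \<in> Orig ` e \<longleftrightarrow> False" for e
    using assms(1) by blast
  then have "deg_in (reroute I a b h k M) x =
      (\<Sum>i\<in>I. of_bool (x \<in> {Orig (a i), h i}) + of_bool (x \<in> {Orig (b i), k i}))"
    by (simp only: deg_in_eq_sum[OF finite_reroute] sum_reroute of_bool_eq sum.neutral_const add_0)
  also have "\<dots> = (\<Sum>i\<in>I. if i = j then of_bool (x = h j) + of_bool (x = k j) else 0)"
  proof (intro sum.cong refl)
    fix i assume "i \<in> I"
    then have "i \<noteq> j \<Longrightarrow> x \<noteq> h i \<and> x \<noteq> k i"
      using assms(3) by blast
    moreover have "x \<noteq> Orig y" for y
      using assms(1) by blast
    ultimately show "of_bool (x \<in> {Orig (a i), h i}) + of_bool (x \<in> {Orig (b i), k i}) =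
        (if i = j then of_bool (x = h j) + of_bool (x = k j) else (0::nat))"
      by simp
  qed
  also have "\<dots> = of_bool (x = h j) + of_bool (x = k j)"
    using finI assms(2) by simp
  finally show ?thesis .
qed

end

theorem theorem2:
  fixes t :: nat and G :: "'a ugraph" and w :: "'a set \<Rightarrow> real"
    and r :: "'a ugraph \<Rightarrow> 'a \<Rightarrow> real" and V1 V2 :: "'a ugraph \<Rightarrow> 'a set"
    and Mbar :: "'a set set"
  assumes "t \<ge> 3"
    and "simple_graph G"
    and "\<forall>v\<in>verts G. 1 \<le> deg_in (edges G) v \<and> deg_in (edges G) v \<le> t + 1"
    and "\<forall>e\<in>edges G. 0 \<le> w e"
    and "\<forall>H\<in>forbidden t G. vertex_induced w H"
    and "pairwise (\<lambda>H1 H2. verts H1 \<inter> verts H2 = {}) (forbidden t G)"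
    and "\<forall>H\<in>forbidden t G. potential_on w H (r H)"
    and "\<forall>H\<in>bicliques t G. complete_bipartite t (V1 H) (V2 H) H"
    and "covering_co_t_matching t G Mbar"
  shows "\<exists>M'. lb_matching (aux_graph t G V1 V2) (aux_lower t G) (aux_upper t G) M' \<and>
    sum (aux_weight w r) M' = sum w Mbar"
proof -
  let ?F = "forbidden t G"
  have cover: "co_t_matching t G Mbar" "\<forall>H\<in>?F. \<not> edges H \<subseteq> edges G - Mbar"
    using assms(9) by (auto simp: covering_co_t_matching_def)
  then have M_sub: "Mbar \<subseteq> edges G" and co_deg: "\<forall>v\<in>verts G. deg_in (edges G - Mbar) v \<le> t"
    by (auto simp: co_t_matching_def t_matching_def)
  have finE: "finite (edges G)"
    using assms(2) by (rule finite_edges)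
  then have finM: "finite Mbar"
    using M_sub finite_subset by blast
  have sub: "subgraph H G" if "H \<in> ?F" for H
    using that by (auto simp: forbidden_def cliques_def bicliques_def)
  have not_both: "H \<notin> cliques t G" if "H \<in> bicliques t G" for H
    using that complete_not_complete_bipartite[of t H] assms(1)
    by (auto simp: cliques_def bicliques_def)

  \<comment> \<open>The covering property supplies the edge. In a biclique its ends are ordered to
    fit the fixed colour classes, so that each end is adjacent to its own hub; in a clique either
    order works.\<close>
  have "\<exists>u v. {u, v} \<in> Mbar \<inter> edges H \<and> u \<noteq> v \<and> {u, v} \<subseteq> verts H \<and>
      (H \<in> bicliques t G \<longrightarrow> u \<in> V1 H \<and> v \<in> V2 H)" if H: "H \<in> ?F" for H
  proof -
    obtain e where e: "e \<in> edges H" "e \<in> Mbar"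
      using cover(2) H sub[OF H] unfolding subgraph_def by blast
    show ?thesis
    proof (cases "H \<in> bicliques t G")
      case True
      then have V12: "complete_bipartite t (V1 H) (V2 H) H"
        using assms(8) by blast
      then obtain u v where uv: "e = {u, v}" "u \<in> V1 H" "v \<in> V2 H"
        using e(1) by (auto simp: complete_bipartite_def)
      with V12 have "u \<noteq> v" "{u, v} \<subseteq> verts H"
        by (auto simp: complete_bipartite_def)
      with e uv show ?thesis
        by auto
    next
      case False
      obtain u v where "e = {u, v}" "u \<in> verts H" "v \<in> verts H" "u \<noteq> v"
        using e(1) sub[OF H] unfolding subgraph_def simple_graph_def by blast
      with e False show ?thesis
        by auto
    qed
  qed
  then obtain a b where "\<forall>H\<in>?F. {a H, b H} \<in> Mbar \<inter> edges H \<and> a H \<noteq> b H \<and>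
      {a H, b H} \<subseteq> verts H \<and> (H \<in> bicliques t G \<longrightarrow> a H \<in> V1 H \<and> b H \<in> V2 H)"
    by metis
  then have ab: "\<And>H. H \<in> ?F \<Longrightarrow> {a H, b H} \<in> Mbar \<inter> edges H"
      "\<And>H. H \<in> ?F \<Longrightarrow> a H \<noteq> b H" "\<And>H. H \<in> ?F \<Longrightarrow> {a H, b H} \<subseteq> verts H"
      "\<And>H. H \<in> ?F \<Longrightarrow> H \<in> bicliques t G \<Longrightarrow> a H \<in> V1 H \<and> b H \<in> V2 H"
    by blast+
  have same: "H = K" if "H \<in> ?F" "K \<in> ?F" "v \<in> verts H" "v \<in> verts K" for H K v
    using assms(6) that by (auto simp: pairwise_def)
  have "a H \<in> verts H" "b H \<in> verts H" if "H \<in> ?F" for H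
    using ab(3)[OF that] by auto
  then have inj: "inj_on a ?F" "inj_on b ?F"
    using same by (metis inj_onI)+
  \<comment> \<open>A common value would be a shared vertex and force \<open>H = K\<close>, but the
    ends of a single chosen edge differ.\<close>
  have neq: "a H \<noteq> b K" if "H \<in> ?F" "K \<in> ?F" for H K
    using same[OF that, of "a H"] ab(2)[OF that(1)] ab(3)[OF that(1)] ab(3)[OF that(2)] by auto
  have "a ` ?F \<subseteq> verts G"
    using ab(3) sub by (fastforce simp: subgraph_def)
  \<comment> \<open>The map \<open>a\<close> embeds the forbidden family into the finite vertex set
    of \<open>G\<close>.\<close>
  then have finF: "finite ?F"
    using assms(2) inj(1) by (auto simp: simple_graph_def intro: inj_on_finite)

  define h where "h H = (if H \<in> cliques t G then KHub H else BHub1 H)" for H :: "'a ugraph"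
  define k where "k H = (if H \<in> cliques t G then KHub H else BHub2 H)" for H :: "'a ugraph"
  have hub: "h H \<notin> range Orig" "k H \<notin> range Orig" for H
    by (auto simp: h_def k_def)
  define M' where "M' = reroute ?F a b h k Mbar"
  have chosen: "{a H, b H} \<in> Mbar" if "H \<in> ?F" for H
    using ab(1)[OF that] by blast
  note ctx = finM finF chosen inj neq hub

  have "sum (aux_weight w r) M' = (\<Sum>e\<in>Mbar. aux_weight w r (Orig ` e))"
    unfolding M'_def
  proof (rule sum_reroute_eq[OF ctx])
    fix H assume H: "H \<in> ?F"
    have "aux_weight w r {Orig (a H), h H} + aux_weight w r {Orig (b H), k H} = r H (a H) + r H (b H)"
      by (simp add: h_def k_def aux_weight_hub)
    also have "\<dots> = w {a H, b H}"
      using assms(7) ab(1)[OF H] H by (auto simp: potential_on_def)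
    finally show "aux_weight w r {Orig (a H), h H} + aux_weight w r {Orig (b H), k H} =
        aux_weight w r (Orig ` {a H, b H})"
      by (simp only: aux_weight_Orig)
  qed
  then have weight: "sum (aux_weight w r) M' = sum w Mbar"
    by (simp add: aux_weight_Orig)

  have M'_sub: "M' \<subseteq> edges (aux_graph t G V1 V2)"
  proof -
    have "{Orig (a H), h H} \<in> edges (aux_graph t G V1 V2) \<and>
        {Orig (b H), k H} \<in> edges (aux_graph t G V1 V2)" if H: "H \<in> ?F" for H
    proof (cases "H \<in> cliques t G")
      case True
      then show ?thesis
        using ab(3)[OF H] by (auto simp: aux_graph_def h_def k_def)
    next
      case False
      then have "H \<in> bicliques t G"
        using H by (simp add: forbidden_def)
      then show ?thesis
        using ab(4)[OF H] False by (auto simp: aux_graph_def h_def k_def)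
    qed
    moreover have "(`) Orig ` (Mbar - X) \<subseteq> edges (aux_graph t G V1 V2)" for X
      using M_sub by (auto simp: aux_graph_def)
    ultimately show ?thesis
      unfolding M'_def reroute_def by blast
  qed

  have "aux_lower t G x \<le> deg_in M' x \<and> deg_in M' x \<le> aux_upper t G x"
    if x: "x \<in> verts (aux_graph t G V1 V2)" for x
  proof -
    \<comment> \<open>Hubs carry their subgraph as constructor argument, so a hub of
      \<open>H\<close> is never a hub of another subgraph.\<close>
    have hub_deg: "deg_in M' x = of_bool (x = h H) + of_bool (x = k H)"
      if "x \<in> {KHub H, BHub1 H, BHub2 H}" "H \<in> ?F" for H
      unfolding M'_def using that
      by (intro deg_in_reroute_hub[OF ctx]) (auto simp: h_def k_def split: if_splits)
    from x consider v where "v \<in> verts G" "x = Orig v"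
      | H where "H \<in> cliques t G" "x = KHub H"
      | H where "H \<in> bicliques t G" "x = BHub1 H \<or> x = BHub2 H"
      by (auto simp: aux_graph_def)
    then show ?thesis
    proof cases
      case (1 v)
      have deg: "deg_in M' (Orig v) = deg_in Mbar v"
        unfolding M'_def by (rule deg_in_reroute_Orig[OF ctx])
      have "deg_in (edges G) v = deg_in Mbar v + deg_in (edges G - Mbar) v"
        using sum.subset_diff[OF M_sub finE] finE finM
        by (simp only: deg_in_eq_sum finite_Diff add.commute)
      \<comment> \<open>If \<open>v\<close> has degree \<open>t + 1\<close> in \<open>G\<close>, at
        most \<open>t\<close> of its edges avoid \<open>Mbar\<close>, hence at least one lies in
        \<open>Mbar\<close>: this is the lower bound 1. The upper bound is the degree in
        \<open>G\<close> in either case.\<close>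
      then show ?thesis
        using bspec[OF co_deg 1(1)] by (auto simp: 1(2) deg)
    next
      case (2 H)
      then show ?thesis
        using hub_deg[of H] by (simp add: forbidden_def h_def k_def)
    next
      \<comment> \<open>By \<open>not_both\<close>, \<open>h H\<close> and \<open>k H\<close> are
        here the distinct hubs \<open>BHub1 H\<close> and \<open>BHub2 H\<close>, so exactly one
        indicator is 1.\<close>
      case (3 H)
      then show ?thesis
        using hub_deg[of H] not_both[of H] by (auto simp: forbidden_def h_def k_def)
    qed
  qed
  with M'_sub weight show ?thesis
    unfolding lb_matching_def by blast
qed

end
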